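(* Let $N\ge 1$. Almost all signals $f = \sum_{j=1}^{N} c_j^{(0)}\,\delta(\cdot - T_j)$ with $c_j^{(0)}\in\mathbb{C}$ and real $T_1<\dots<T_N$ can be uniquely recovered from their Fourier intensities $|\widehat f|$ up to trivial ambiguities. That is, for all parameters $(c_1^{(0)},\dots,c_N^{(0)},T_1,\dots,T_N) \in \mathbb{C}^N\times\mathbb{R}^N \cong \mathbb{R}^{3N}$ with $T_1<\dots<T_N$ outside a set of Lebesgue measure zero, the corresponding signal $f$ has the following property: every signal $g = \sum_{j=1}^{N} d_j\,\delta(\cdot - S_j)$ with $d_j\in\mathbb{C}$, $S_1<\dots<S_N$ real, and $|\widehat g(\omega)| = |\widehat f(\omega)|$ for all $\omega\in\mathbb{R}$ coincides with $f$ up to trivial ambiguities.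
   Context: Here $\delta$ is the Dirac delta distribution. For $f = \sum_{j=1}^{N} c_j^{(0)} \delta(\cdot - T_j)$ the Fourier transform is $\widehat f(\omega) = \sum_{j=1}^N c_j^{(0)} e^{-\mathrm{i}\omega T_j}$, $\omega \in \mathbb{R}$. "Almost all" refers to Lebesgue measure on $\mathbb{R}^{3N}$, with which the space of these signals is identified through the real and imaginary parts of the coefficients and the knots. Trivial ambiguities: rotation $f \mapsto e^{\mathrm{i}\alpha} f$ ($\alpha\in\mathbb{R}$), time shift $f \mapsto f(\cdot - t_0)$ ($t_0 \in \mathbb{R}$), conjugation and reflection $f \mapsto \overline{f(-\cdot)}$, and combinations of these. Two signals coincide up to trivial ambiguities if one is obtained from the other by such a combination, i.e. $g = e^{\mathrm{i}\alpha} f(\cdot - t_0)$ or $g = e^{\mathrm{i}\alpha}\, \overline{f(t_0-\cdot)}$ for some $\alpha,t_0\in\mathbb{R}$. On spike signals these act by $f(\cdot-t_0) = \sum_j c_j^{(0)} \delta(\cdot - T_j - t_0)$ and $\overline{f(-\cdot)} = \sum_j \overline{c_j^{(0)}}\, \delta(\cdot + T_j)$. *)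

theory Defs
  imports "HOL-Analysis.Analysis"
begin

text \<open>
  A signal is given by its pairing with functions on the real line, as a distribution is. Finite
  sums of point evaluations are defined on arbitrary functions, in particular on test functions
  and on the (non-compactly supported) complex exponentials. Two such sums that agree on all test
  functions have the same coefficients and hence agree on all functions, so that for spike signals
  equality of the functionals is equality of the distributions.
\<close>

type_synonym signal = "(real \<Rightarrow> complex) \<Rightarrow> complex"

definition dirac :: signal where
  "dirac = (\<lambda>\<phi>. \<phi> 0)"

definition rotation :: "real \<Rightarrow> signal \<Rightarrow> signal" where
  "rotation \<alpha> f = (\<lambda>\<phi>. exp (\<i> * complex_of_real \<alpha>) * f \<phi>)"

text \<open>The next two operations are the transposes of \<open>f \<mapsto> f(\<cdot> - t\<^sub>0)\<close> and
  \<open>f \<mapsto> cnj (f(- \<cdot>))\<close>, as obtained from the pairing \<open>\<integral> f(t) \<phi>(t) dt\<close> by substitution.\<close>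

definition time_shift :: "real \<Rightarrow> signal \<Rightarrow> signal" where
  "time_shift t\<^sub>0 f = (\<lambda>\<phi>. f (\<lambda>t. \<phi> (t + t\<^sub>0)))"

definition conj_reflection :: "signal \<Rightarrow> signal" where
  "conj_reflection f = (\<lambda>\<phi>. cnj (f (\<lambda>t. cnj (\<phi> (- t)))))"

definition fourier :: "signal \<Rightarrow> real \<Rightarrow> complex" where
  "fourier f \<omega> = f (\<lambda>t. exp (- (\<i> * complex_of_real \<omega> * complex_of_real t)))"

text \<open>The number of spikes is \<open>N = CARD('n) \<ge> 1\<close>. A linear order on \<open>'n\<close> turns
  \<open>T\<^sub>1 < \<dots> < T\<^sub>N\<close> into strict monotonicity of the components of \<open>T\<close>. Lebesgue measure on the
  Euclidean space \<open>(complex ^ 'n) \<times> (real ^ 'n)\<close> is that of \<open>\<real>\<^bsup>3N\<^esup>\<close> under the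
  identification by real parts, imaginary parts and knots.\<close>

definition spike_signal :: "complex ^ 'n \<Rightarrow> real ^ 'n \<Rightarrow> signal" where
  "spike_signal c T = (\<lambda>\<phi>. \<Sum>j\<in>UNIV. c $ j * time_shift (T $ j) dirac \<phi>)"

text \<open>The second disjunct is \<open>g = exp (\<i> * \<alpha>) * cnj (f(t\<^sub>0 - \<cdot>))\<close>.\<close>

definition coincide_up_to_trivial_ambiguities :: "signal \<Rightarrow> signal \<Rightarrow> bool" where
  "coincide_up_to_trivial_ambiguities f g \<longleftrightarrow>
     (\<exists>\<alpha> t\<^sub>0. g = rotation \<alpha> (time_shift t\<^sub>0 f) \<or>
              g = rotation \<alpha> (time_shift t\<^sub>0 (conj_reflection f)))"

lemma fourier_spike_signal:
  "fourier (spike_signal c T) \<omega> =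
     (\<Sum>j\<in>UNIV. c $ j * exp (- (\<i> * complex_of_real \<omega> * complex_of_real (T $ j))))"
  by (simp add: fourier_def spike_signal_def time_shift_def dirac_def)

lemma rotation_spike_signal:
  "rotation \<alpha> (spike_signal c T) = spike_signal (\<chi> j. exp (\<i> * complex_of_real \<alpha>) * c $ j) T"
  by (simp add: rotation_def spike_signal_def sum_distrib_left mult.assoc)

lemma time_shift_spike_signal:
  "time_shift t\<^sub>0 (spike_signal c T) = spike_signal c (\<chi> j. T $ j + t\<^sub>0)"
  by (simp add: spike_signal_def time_shift_def dirac_def add.assoc)

lemma conj_reflection_spike_signal:
  "conj_reflection (spike_signal c T) = spike_signal (\<chi> j. cnj (c $ j)) (\<chi> j. - (T $ j))"
  by (simp add: conj_reflection_def spike_signal_def time_shift_def dirac_def)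

end

theory Submission
  imports Defs
begin

text \<open>
  Complex exponentials with distinct frequencies are linearly independent, so the Fourier intensity
  determines the autocorrelation \<open>\<Sum> c\<^sub>j cnj c\<^sub>k \<delta>(\<cdot> - (T\<^sub>j - T\<^sub>k))\<close>. Generically the knots \<open>T\<close> are
  independent over the integers, the coefficients do not vanish, and \<open>\<bar>c\<^sub>1\<bar> \<noteq> \<bar>c\<^sub>N\<bar>\<close>. Then the
  differences of \<open>S\<close> are in bijection with those of \<open>T\<close>, and the largest ones agree. Splitting
  the largest difference at an intermediate knot, \<open>S\<^sub>N - S\<^sub>1 = (S\<^sub>N - S\<^sub>k) + (S\<^sub>k - S\<^sub>1)\<close>, independence
  leaves two possibilities, \<open>S\<^sub>k - S\<^sub>1 = T\<^sub>b - T\<^sub>1\<close> or \<open>S\<^sub>k - S\<^sub>1 = T\<^sub>N - T\<^sub>a\<close>. The moduli of the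
  three products of coefficients force \<open>\<bar>d\<^sub>1\<bar> = \<bar>c\<^sub>1\<bar>\<close> in the first case and \<open>\<bar>d\<^sub>1\<bar> = \<bar>c\<^sub>N\<bar>\<close> in the
  second, so the same case occurs for all \<open>k\<close>: the first is a shift, the second a reflection.
\<close>

section \<open>Linear independence of complex exponentials\<close>

lemma exponentials_independent:
  fixes a :: "real \<Rightarrow> complex"
  assumes "finite X"
    and "\<And>\<omega>::real. (\<Sum>x\<in>X. a x * exp (- (\<i> * of_real \<omega> * of_real x))) = 0"
    and "x \<in> X"
  shows "a x = 0"
  using assms
proof (induction X arbitrary: a x rule: finite_induct)
  case empty
  then show ?case by simp
next
  case (insert y X)
  \<comment> \<open>Multiplying by \<open>exp (\<i> * \<omega> * y)\<close> and differentiating in \<open>\<omega>\<close> removes the frequency \<open>y\<close>.\<close>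
  have *: "(\<Sum>x\<in>X. a x * of_real (x - y) * exp (- (\<i> * of_real \<omega> * of_real x))) = 0" for \<omega> :: real
  proof -
    have "((\<lambda>\<omega>. \<Sum>x\<in>insert y X. a x * exp (- (\<i> * of_real \<omega> * of_real (x - y))))
        has_vector_derivative
        (\<Sum>x\<in>insert y X. a x * (- (\<i> * of_real (x - y)) * exp (- (\<i> * of_real \<omega> * of_real (x - y)))))) (at \<omega>)"
      by (intro has_vector_derivative_sum has_vector_derivative_real_field)
        (auto intro!: derivative_eq_intros)
    moreover have "(\<Sum>x\<in>insert y X. a x * exp (- (\<i> * of_real \<omega> * of_real (x - y)))) = 0" for \<omega> :: real
    proof -
      have "(\<Sum>x\<in>insert y X. a x * exp (- (\<i> * of_real \<omega> * of_real (x - y))))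
          = exp (\<i> * of_real \<omega> * of_real y) * (\<Sum>x\<in>insert y X. a x * exp (- (\<i> * of_real \<omega> * of_real x)))"
        unfolding sum_distrib_left by (intro sum.cong) (simp_all add: algebra_simps flip: exp_add)
      then show ?thesis using insert.prems(1) by simp
    qed
    ultimately have "(\<Sum>x\<in>insert y X. a x * (- (\<i> * of_real (x - y)) * exp (- (\<i> * of_real \<omega> * of_real (x - y))))) = 0"
      by (metis (no_types, lifting) has_vector_derivative_const vector_derivative_unique_at ext)
    then have "0 = \<i> * exp (- (\<i> * of_real \<omega> * of_real y)) *
        (\<Sum>x\<in>X. a x * (- (\<i> * of_real (x - y)) * exp (- (\<i> * of_real \<omega> * of_real (x - y)))))"
      using insert.hyps by simp
    also have "\<dots> = (\<Sum>x\<in>X. a x * of_real (x - y) * exp (- (\<i> * of_real \<omega> * of_real x)))"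
      unfolding sum_distrib_left
      by (intro sum.cong) (simp_all add: algebra_simps flip: exp_add)
    finally show ?thesis by simp
  qed
  \<comment> \<open>The induction hypothesis gives \<open>a x * (x - y) = 0\<close>, and
    \<open>x - y\<close> is nonzero because \<open>y\<close> is not in \<open>X\<close>.\<close>
  have X: "a x = 0" if "x \<in> X" for x
    using insert.IH[of "\<lambda>x. a x * of_real (x - y)" x, OF * that] insert.hyps that by auto
  then have "a y = 0"
    using insert.prems(1)[of 0] insert.hyps by simp
  with X insert.prems(2) show ?case by auto
qed

text \<open>Several terms may share a frequency, so only the total coefficient at each frequency is
  determined.\<close>

lemma exponential_sums_eqD:
  fixes a b :: "'i \<Rightarrow> complex" and u v :: "'i \<Rightarrow> real"
  assumes fin: "finite P"
    and eq: "\<And>\<omega>::real. (\<Sum>p\<in>P. a p * exp (- (\<i> * of_real \<omega> * of_real (u p))))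
                     = (\<Sum>p\<in>P. b p * exp (- (\<i> * of_real \<omega> * of_real (v p))))"
  shows "(\<Sum>p | p \<in> P \<and> u p = x. a p) = (\<Sum>p | p \<in> P \<and> v p = x. b p)"
proof -
  \<comment> \<open>Inserting \<open>x\<close> covers values that occur on neither side, where both
    sums are empty.\<close>
  define X where "X = insert x (u ` P \<union> v ` P)"
  have X: "finite X" "u ` P \<subseteq> X" "v ` P \<subseteq> X" "x \<in> X"
    using fin by (auto simp: X_def)
  have group: "(\<Sum>p\<in>P. a p * exp (- (\<i> * of_real \<omega> * of_real (u p))))
      = (\<Sum>x\<in>X. (\<Sum>p | p \<in> P \<and> u p = x. a p) * exp (- (\<i> * of_real \<omega> * of_real x)))"
    if "u ` P \<subseteq> X" for a :: "'i \<Rightarrow> complex" and u and \<omega> :: real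
    unfolding sum.group[OF fin X(1) that, symmetric] sum_distrib_right
    by (intro sum.cong) auto
  have "(\<Sum>p | p \<in> P \<and> u p = x. a p) - (\<Sum>p | p \<in> P \<and> v p = x. b p) = 0"
  proof (rule exponentials_independent[OF X(1) _ X(4)])
    fix \<omega> :: real
    show "(\<Sum>x\<in>X. ((\<Sum>p | p \<in> P \<and> u p = x. a p) - (\<Sum>p | p \<in> P \<and> v p = x. b p))
        * exp (- (\<i> * of_real \<omega> * of_real x))) = 0"
      using eq[of \<omega>] by (simp add: group[OF X(2)] group[OF X(3)] left_diff_distrib sum_subtractf)
  qed
  then show ?thesis by simp
qed

section \<open>Autocorrelation of a spike signal\<close>

definition autocorrelation :: "complex ^ 'n \<Rightarrow> real ^ 'n \<Rightarrow> real \<Rightarrow> complex" where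
  "autocorrelation c T x = (\<Sum>(j, k) | T $ j - T $ k = x. c $ j * cnj (c $ k))"

lemma cmod_fourier_spike_signal_squared:
  "complex_of_real ((cmod (fourier (spike_signal c T) \<omega>))\<^sup>2) =
     (\<Sum>p\<in>UNIV. c $ fst p * cnj (c $ snd p) *
        exp (- (\<i> * of_real \<omega> * of_real (T $ fst p - T $ snd p))))"
proof -
  have "complex_of_real ((cmod (fourier (spike_signal c T) \<omega>))\<^sup>2) =
    (\<Sum>j\<in>UNIV. \<Sum>k\<in>UNIV. (c $ j * exp (- (\<i> * of_real \<omega> * of_real (T $ j)))) *
       cnj (c $ k * exp (- (\<i> * of_real \<omega> * of_real (T $ k)))))"
    unfolding complex_norm_square fourier_spike_signal cnj_sum sum_product ..
  also have "\<dots> = (\<Sum>j\<in>UNIV. \<Sum>k\<in>UNIV. c $ j * cnj (c $ k) *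
       exp (- (\<i> * of_real \<omega> * of_real (T $ j - T $ k))))"
    by (intro sum.cong refl) (simp add: exp_cnj algebra_simps flip: exp_add)
  finally show ?thesis
    by (simp add: sum.cartesian_product case_prod_unfold)
qed

lemma autocorrelation_eq:
  fixes c d :: "complex ^ 'n"
  assumes "\<And>\<omega>. cmod (fourier (spike_signal d S) \<omega>) = cmod (fourier (spike_signal c T) \<omega>)"
  shows "autocorrelation d S x = autocorrelation c T x"
proof -
  have "(\<Sum>p | p \<in> UNIV \<and> S $ fst p - S $ snd p = x. d $ fst p * cnj (d $ snd p)) =
        (\<Sum>p | p \<in> UNIV \<and> T $ fst p - T $ snd p = x. c $ fst p * cnj (c $ snd p))"
    by (rule exponential_sums_eqD)
      (use assms in \<open>simp_all only: finite flip: cmod_fourier_spike_signal_squared\<close>)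
  then show ?thesis
    by (simp add: autocorrelation_def case_prod_unfold)
qed

text \<open>Only diagonal pairs have difference 0, so this value is the energy. It serves the case
  of at most two spikes, where there is no intermediate knot.\<close>

lemma autocorrelation_0:
  assumes "inj (($) T)"
  shows "autocorrelation c T 0 = of_real (\<Sum>j\<in>UNIV. (cmod (c $ j))\<^sup>2)"
proof -
  have "{(j, k). T $ j - T $ k = 0} = (\<lambda>j. (j, j)) ` UNIV"
    using assms by (auto simp: inj_def)
  then have "autocorrelation c T 0 = (\<Sum>j\<in>UNIV. c $ j * cnj (c $ j))"
    unfolding autocorrelation_def by (simp add: sum.reindex inj_def)
  then show ?thesis
    by (simp add: complex_norm_square del: of_real_power)
qed

section \<open>Matching the knot differences\<close>

definition distinct_differences :: "real ^ 'n \<Rightarrow> bool" where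
  "distinct_differences T \<longleftrightarrow> inj_on (\<lambda>(j, k). T $ j - T $ k) {(j, k). j \<noteq> k}"

lemma distinct_differencesD:
  assumes "distinct_differences T" "T $ a - T $ b = T $ j - T $ k" "j \<noteq> k" "a \<noteq> b"
  shows "a = j" "b = k"
  using assms inj_onD[of "\<lambda>(j, k). T $ j - T $ k" "{(j, k). j \<noteq> k}" "(a, b)" "(j, k)"]
  by (simp_all add: distinct_differences_def)

lemma autocorrelation_difference:
  assumes "distinct_differences T" "inj (($) T)" "j \<noteq> k"
  shows "autocorrelation c T (T $ j - T $ k) = c $ j * cnj (c $ k)"
proof -
  have "a = j \<and> b = k" if "T $ a - T $ b = T $ j - T $ k" for a b
  proof (cases "a = b")
    case True
    then have "T $ j = T $ k" using that by simp
    then show ?thesis using assms by (auto simp: inj_def)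
  qed (use that assms distinct_differencesD in blast)
  then have "{(a, b). T $ a - T $ b = T $ j - T $ k} = {(j, k)}"
    by auto
  then show ?thesis by (simp add: autocorrelation_def)
qed

text \<open>A difference of \<open>T\<close> has nonzero autocorrelation, hence occurs among those
  of \<open>S\<close>. Both families are indexed by the same finite set of pairs and those of
  \<open>T\<close> are distinct, so counting turns the inclusion into an equality and makes the
  differences of \<open>S\<close> distinct.\<close>

lemma differences_match:
  fixes T S :: "real ^ 'n"
  assumes T: "distinct_differences T" "inj (($) T)" and c: "\<And>j. c $ j \<noteq> 0"
    and S: "inj (($) S)"
    and eq: "\<And>x. autocorrelation d S x = autocorrelation c T x"
  shows "distinct_differences S"
    and "j \<noteq> k \<Longrightarrow> \<exists>a b. a \<noteq> b \<and> S $ j - S $ k = T $ a - T $ b"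
    and "a \<noteq> b \<Longrightarrow> \<exists>j k. j \<noteq> k \<and> T $ a - T $ b = S $ j - S $ k"
proof -
  define P where "P = {(j, k :: 'n). j \<noteq> k}"
  define \<Delta>T where "\<Delta>T = (\<lambda>(j, k). T $ j - T $ k)"
  define \<Delta>S where "\<Delta>S = (\<lambda>(j, k). S $ j - S $ k)"
  have sub: "\<Delta>T ` P \<subseteq> \<Delta>S ` P"
  proof safe
    fix a b assume "(a, b) \<in> P"
    then have "a \<noteq> b" by (simp add: P_def)
    have "autocorrelation d S (T $ a - T $ b) \<noteq> 0"
      using autocorrelation_difference[OF T \<open>a \<noteq> b\<close>, of c] c by (simp add: eq)
    then obtain p where p: "S $ fst p - S $ snd p = T $ a - T $ b"
      unfolding autocorrelation_def by (metis (mono_tags, lifting) case_prod_unfold mem_Collect_eq sum.neutral)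
    moreover have "fst p \<noteq> snd p"
      using p T(2) \<open>a \<noteq> b\<close> by (auto simp: inj_def)
    ultimately show "\<Delta>T (a, b) \<in> \<Delta>S ` P"
      by (intro image_eqI[of _ _ p]) (auto simp: P_def \<Delta>T_def \<Delta>S_def case_prod_unfold)
  qed
  have "card (\<Delta>T ` P) = card P"
    using T(1) by (intro card_image) (simp add: distinct_differences_def P_def \<Delta>T_def)
  moreover have "card (\<Delta>S ` P) \<le> card P" "card (\<Delta>T ` P) \<le> card (\<Delta>S ` P)"
    by (auto intro!: card_image_le card_mono sub)
  ultimately have card: "card (\<Delta>S ` P) = card P" "card (\<Delta>T ` P) = card (\<Delta>S ` P)" by auto
  show "distinct_differences S"
    using eq_card_imp_inj_on[OF _ card(1)] by (simp add: distinct_differences_def P_def \<Delta>S_def)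
  have img: "\<Delta>T ` P = \<Delta>S ` P"
    using card_subset_eq[OF _ sub card(2)] by simp
  show "\<exists>a b. a \<noteq> b \<and> S $ j - S $ k = T $ a - T $ b" if "j \<noteq> k" for j k
  proof -
    have "\<Delta>S (j, k) \<in> \<Delta>T ` P" unfolding img using that by (simp add: P_def)
    then show ?thesis by (auto simp: \<Delta>T_def \<Delta>S_def P_def)
  qed
  show "\<exists>j k. j \<noteq> k \<and> T $ a - T $ b = S $ j - S $ k" if "a \<noteq> b" for a b
  proof -
    have "\<Delta>T (a, b) \<in> \<Delta>S ` P" unfolding img[symmetric] using that by (simp add: P_def)
    then show ?thesis by (auto simp: \<Delta>T_def \<Delta>S_def P_def)
  qed
qed

section \<open>Integral independence of the knots\<close>

text \<open>This is linear independence over the rationals with denominators cleared. There are only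
  countably many \<open>v\<close>, which later makes the exceptional set null.\<close>

definition integrally_independent :: "real ^ 'n \<Rightarrow> bool" where
  "integrally_independent T \<longleftrightarrow>
     (\<forall>v :: 'n \<Rightarrow> int. (\<Sum>j\<in>UNIV. of_int (v j) * T $ j) = 0 \<longrightarrow> v = (\<lambda>_. 0))"

text \<open>Equal sums of knots have equal index multisets. Three terms a side are what a difference
  split into two differences produces.\<close>

lemma integrally_independentD:
  fixes T :: "real ^ 'n"
  assumes "integrally_independent T"
    and "T $ a + T $ b + T $ c = T $ p + T $ q + T $ r"
  shows "(of_bool (i = a) + of_bool (i = b) + of_bool (i = c) :: int)
       = of_bool (i = p) + of_bool (i = q) + of_bool (i = r)"
proof -
  define v where "v = (\<lambda>i. (of_bool (i = a) + of_bool (i = b) + of_bool (i = c) :: int)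
       - (of_bool (i = p) + of_bool (i = q) + of_bool (i = r)))"
  have "(\<Sum>j\<in>UNIV. of_int (v j) * T $ j) = T $ a + T $ b + T $ c - (T $ p + T $ q + T $ r)"
    by (simp add: v_def left_diff_distrib distrib_right sum.distrib sum_subtractf)
  then have "v i = 0"
    using assms unfolding integrally_independent_def by (metis eq_iff_diff_eq_0)
  then show ?thesis by (simp add: v_def)
qed

lemma integrally_independent_distinct_differences:
  assumes "integrally_independent T"
  shows "distinct_differences T"
proof -
  have "a = j \<and> b = k" if "T $ a - T $ b = T $ j - T $ k" "j \<noteq> k" "a \<noteq> b" for a b j k
  proof -
    \<comment> \<open>Adding \<open>T $ k\<close> to both sides pads a relation with two terms a
      side to three.\<close>
    have "T $ a + T $ k + T $ k = T $ j + T $ b + T $ k" using that by simp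
    from integrally_independentD[OF assms this, of a] integrally_independentD[OF assms this, of b] 
    show ?thesis using that by (auto simp: of_bool_def split: if_splits)
  qed
  then show ?thesis by (auto simp: distinct_differences_def inj_on_def)
qed

text \<open>The multisets \<open>{p, b, e}\<close> and \<open>{q, a, c}\<close> agree. As
  \<open>p\<close> differs from \<open>q\<close>, it is \<open>a\<close> or \<open>c\<close>, and
  the other two inequalities fix the rest: the summands join at a common knot, in one of two
  orders.\<close>

lemma integrally_independent_triangle:
  assumes "integrally_independent T"
    and "T $ p - T $ q = (T $ a - T $ b) + (T $ c - T $ e)"
    and "p \<noteq> q" "a \<noteq> b" "c \<noteq> e"
  shows "(a = p \<and> b = c \<and> e = q) \<or> (c = p \<and> e = a \<and> b = q)"
proof -
  have eq: "T $ p + T $ b + T $ e = T $ q + T $ a + T $ c" using assms(2) by simp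
  show ?thesis
    using integrally_independentD[OF assms(1) eq, of p] integrally_independentD[OF assms(1) eq, of b]
      integrally_independentD[OF assms(1) eq, of e] assms(3-)
    by (auto simp: of_bool_def split: if_splits)
qed

section \<open>From matched differences to trivial ambiguities\<close>

text \<open>The numbering of the spikes is immaterial, so a matching of spikes need only be
  injective, not monotone.\<close>

lemma spike_signal_reindex:
  fixes b :: "'n::finite \<Rightarrow> 'n"
  assumes "inj b"
  shows "spike_signal (\<chi> k. c $ b k) (\<chi> k. T $ b k) = spike_signal c T"
proof -
  have "bij b" using assms by (simp add: bij_def finite_UNIV_inj_surj)
  show ?thesis
  proof
    fix \<phi>
    show "spike_signal (\<chi> k. c $ b k) (\<chi> k. T $ b k) \<phi> = spike_signal c T \<phi>"
      using sum.reindex_bij_betw[OF \<open>bij b\<close>, of "\<lambda>j. c $ j * time_shift (T $ j) dirac \<phi>"]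
      by (simp add: spike_signal_def)
  qed
qed

lemma unimodular_factor:
  fixes z w :: complex
  assumes "cmod z = cmod w" "w \<noteq> 0"
  obtains \<alpha> where "z = exp (\<i> * complex_of_real \<alpha>) * w"
proof -
  have "cmod (z / w) = 1" using assms by (simp add: norm_divide)
  then obtain \<alpha> where "z / w = exp (\<i> * complex_of_real \<alpha>)"
    by (metis complex_norm_eq_1_exp)
  then show ?thesis using assms by (intro that[of \<alpha>]) (simp add: field_simps)
qed

lemma eq_unimodular_multI:
  fixes x y z u :: complex
  assumes "x * cnj (u * w) = y * cnj w" "cmod u = 1" "w \<noteq> 0"
  shows "x = u * y"
proof -
  have "x * cnj u = y" using assms(1,3) by simp
  then have "u * y = x * (u * cnj u)" by simp
  also have "u * cnj u = 1" using assms(2) by (simp flip: complex_norm_square)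
  finally show ?thesis by simp
qed

text \<open>Spike \<open>m\<close> of one signal is anchored at spike \<open>p\<close> of the other:
  their knots give the shift, their coefficients the phase, and the products with the anchor carry
  both over to every other spike. The reflected case needs an anchor other than
  \<open>m\<close>.\<close>

lemma coincide_shift:
  fixes c d :: "complex ^ 'n::finite"
  assumes S: "inj (($) S)"
    and m: "cmod (d $ m) = cmod (c $ p)" "c $ p \<noteq> 0"
    and match: "\<And>k. \<exists>b. S $ k - S $ m = T $ b - T $ p \<and> d $ k * cnj (d $ m) = c $ b * cnj (c $ p)"
  shows "\<exists>\<alpha> t\<^sub>0. spike_signal d S = rotation \<alpha> (time_shift t\<^sub>0 (spike_signal c T))"
proof -
  obtain \<alpha> where \<alpha>: "d $ m = exp (\<i> * complex_of_real \<alpha>) * c $ p"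
    using unimodular_factor[OF m] .
  obtain b where b: "\<And>k. S $ k - S $ m = T $ b k - T $ p"
    "\<And>k. d $ k * cnj (d $ m) = c $ b k * cnj (c $ p)"
    using match by metis
  have "inj b"
  proof
    fix x y assume "b x = b y"
    with b(1)[of x] b(1)[of y] have "S $ x = S $ y" by simp
    with S show "x = y" by (simp add: inj_def)
  qed
  define c' T' where "c' = (\<chi> j. exp (\<i> * complex_of_real \<alpha>) * c $ j)"
    and "T' = (\<chi> j. T $ j + (S $ m - T $ p))"
  have "d $ k = c' $ b k" for k
    using eq_unimodular_multI[OF b(2)[of k, unfolded \<alpha>] _ m(2)] by (simp add: c'_def)
  moreover have "S $ k = T' $ b k" for k
    using b(1)[of k] by (simp add: T'_def)
  ultimately have "d = (\<chi> k. c' $ b k)" "S = (\<chi> k. T' $ b k)"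
    by (simp_all add: vec_eq_iff)
  then have "spike_signal d S = spike_signal c' T'"
    using spike_signal_reindex[OF \<open>inj b\<close>] by metis
  moreover have "spike_signal c' T' = rotation \<alpha> (time_shift (S $ m - T $ p) (spike_signal c T))"
    by (simp add: rotation_spike_signal time_shift_spike_signal c'_def T'_def)
  ultimately show ?thesis by auto
qed

lemma coincide_up_to_trivial_ambiguitiesI:
  fixes c d :: "complex ^ 'n::{finite,linorder}"
  defines "m \<equiv> Min (UNIV :: 'n set)" and "M \<equiv> Max (UNIV :: 'n set)"
  assumes T: "strict_mono (($) T)" "integrally_independent T"
    and c: "\<And>j. c $ j \<noteq> 0" "m \<noteq> M \<Longrightarrow> cmod (c $ m) \<noteq> cmod (c $ M)"
    and S: "strict_mono (($) S)"
    and eq: "\<And>\<omega>. cmod (fourier (spike_signal d S) \<omega>) = cmod (fourier (spike_signal c T) \<omega>)"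
  shows "coincide_up_to_trivial_ambiguities (spike_signal c T) (spike_signal d S)"
proof -
  have inj: "inj (($) T)" "inj (($) S)"
    using T S by (auto intro: strict_mono_imp_inj_on)
  have auto_eq: "autocorrelation d S x = autocorrelation c T x" for x
    using autocorrelation_eq[OF eq] .
  have dT: "distinct_differences T"
    using T(2) by (rule integrally_independent_distinct_differences)
  note match = differences_match[OF dT inj(1) c(1) inj(2) auto_eq]
  \<comment> \<open>At a nonzero difference each autocorrelation is a single product, so the
    products match along with the differences.\<close>
  have pair: "\<exists>a b. a \<noteq> b \<and> S $ j - S $ k = T $ a - T $ b \<and> d $ j * cnj (d $ k) = c $ a * cnj (c $ b)"
    if jk: "j \<noteq> k" for j k
  proof -
    obtain a b where ab: "a \<noteq> b" "S $ j - S $ k = T $ a - T $ b" using match(2)[OF jk] by blast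
    have "d $ j * cnj (d $ k) = c $ a * cnj (c $ b)"
      using autocorrelation_difference[OF match(1) inj(2) jk, of d]
        autocorrelation_difference[OF dT inj(1) ab(1), of c] auto_eq ab(2) by simp
    with ab show ?thesis by blast
  qed
  have energy: "(\<Sum>j\<in>UNIV. (cmod (d $ j))\<^sup>2) = (\<Sum>j\<in>UNIV. (cmod (c $ j))\<^sup>2)"
    using auto_eq[of 0] by (simp only: autocorrelation_0[OF inj(1)] autocorrelation_0[OF inj(2)] of_real_eq_iff)
  have bounds: "m \<le> j" "j \<le> M" for j :: 'n
    by (auto simp: m_def M_def)
  have extreme: "S $ M - S $ m = T $ M - T $ m \<and> d $ M * cnj (d $ m) = c $ M * cnj (c $ m)"
    if mM: "m \<noteq> M"
  proof -
    obtain a b where ab: "a \<noteq> b" "S $ M - S $ m = T $ a - T $ b"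
      "d $ M * cnj (d $ m) = c $ a * cnj (c $ b)"
      using pair[of M m] mM by blast
    obtain j k where jk: "j \<noteq> k" "T $ M - T $ m = S $ j - S $ k"
      using match(3)[of M m] mM by blast
    have le: "T $ m \<le> T $ i" "T $ i \<le> T $ M" "S $ m \<le> S $ i" "S $ i \<le> S $ M" for i
      using bounds[of i] strict_mono_less_eq[OF T(1)] strict_mono_less_eq[OF S] by auto
    \<comment> \<open>Each of the two largest differences also occurs for the other signal, so
      neither exceeds the other.\<close>
    have "T $ a - T $ b = T $ M - T $ m"
      using le(1)[of b] le(2)[of a] le(3)[of k] le(4)[of j] ab(2) jk(2) by linarith
    then have "a = M" "b = m"
      using distinct_differencesD[OF dT] ab(1) mM by metis+
    with ab show ?thesis by simp
  qed
  \<comment> \<open>The moduli at both ends are recorded because they do not depend on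
    \<open>k\<close> and so link the alternatives for different \<open>k\<close>.\<close>
  have middle: "(\<exists>b. S $ k - S $ m = T $ b - T $ m \<and> d $ k * cnj (d $ m) = c $ b * cnj (c $ m) \<and>
                     cmod (d $ m) = cmod (c $ m) \<and> cmod (d $ M) = cmod (c $ M)) \<or>
                (\<exists>a. S $ k - S $ m = T $ M - T $ a \<and> d $ k * cnj (d $ m) = c $ M * cnj (c $ a) \<and>
                     cmod (d $ m) = cmod (c $ M) \<and> cmod (d $ M) = cmod (c $ m))"
    if k: "k \<noteq> m" "k \<noteq> M" for k
  proof -
    have mM: "m \<noteq> M"
      using bounds[of k] k by auto
    obtain a b where ab: "a \<noteq> b" "S $ M - S $ k = T $ a - T $ b"
      "d $ M * cnj (d $ k) = c $ a * cnj (c $ b)" using pair[of M k] k(2) by blast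
    obtain p q where pq: "p \<noteq> q" "S $ k - S $ m = T $ p - T $ q"
      "d $ k * cnj (d $ m) = c $ p * cnj (c $ q)" using pair[of k m] k(1) by blast
    have "T $ M - T $ m = (T $ a - T $ b) + (T $ p - T $ q)"
      using extreme[OF mM] ab pq by simp
    then have cases: "(a = M \<and> b = p \<and> q = m) \<or> (p = M \<and> q = a \<and> b = m)"
      using integrally_independent_triangle[OF T(2)] ab(1) pq(1) mM by metis
    have moduli: "cmod (d $ M) * cmod (d $ k) = cmod (c $ a) * cmod (c $ b)"
      "cmod (d $ k) * cmod (d $ m) = cmod (c $ p) * cmod (c $ q)"
      "cmod (d $ M) * cmod (d $ m) = cmod (c $ M) * cmod (c $ m)"
      using arg_cong[OF ab(3), of cmod] arg_cong[OF pq(3), of cmod]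
        arg_cong[OF conjunct2[OF extreme[OF mM]], of cmod]
      by (simp_all add: norm_mult)
    \<comment> \<open>The three pairwise products determine positive numbers, since
      \<open>y * y\<close> is \<open>(x * y) * (y * z)\<close> divided by
      \<open>x * z\<close>.\<close>
    have ratio: "x = x' \<and> z = z'"
      if "x * y = x' * y'" "y * z = y' * z'" "x * z = x' * z'"
        "0 \<le> x" "0 \<le> y" "0 \<le> z" "0 < x'" "0 < y'" "0 < z'" for x y z x' y' z' :: real
    proof -
      have "(x * z) * (y * y) = (x * y) * (y * z)" by (simp add: mult_ac)
      also have "\<dots> = (x' * z') * (y' * y')" unfolding that(1,2) by (simp add: mult_ac)
      finally have "y * y = y' * y'" using that by simp
      then have "y = y'" using that by (simp add: power2_eq_square[symmetric])
      then show ?thesis using that by simp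
    qed
    have pos: "cmod (c $ j) > 0" for j using c(1) by simp
    from cases show ?thesis
    proof
      assume *: "a = M \<and> b = p \<and> q = m"
      then show ?thesis
        using ratio[of "cmod (d $ M)" "cmod (d $ k)" "cmod (c $ M)" "cmod (c $ p)" "cmod (d $ m)" "cmod (c $ m)"]
          moduli pq pos by auto
    next
      assume *: "p = M \<and> q = a \<and> b = m"
      then show ?thesis
        using ratio[of "cmod (d $ M)" "cmod (d $ k)" "cmod (c $ m)" "cmod (c $ a)" "cmod (d $ m)" "cmod (c $ M)"]
          moduli pq pos by (auto simp: mult.commute)
    qed
  qed
  have ends: "(cmod (d $ m) = cmod (c $ m) \<and> cmod (d $ M) = cmod (c $ M)) \<or>
              (cmod (d $ m) = cmod (c $ M) \<and> cmod (d $ M) = cmod (c $ m))"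
  proof (cases "\<exists>k. k \<noteq> m \<and> k \<noteq> M")
    case True
    then show ?thesis using middle by blast
  next
    case False
    \<comment> \<open>With at most two spikes, the energy takes the place of
      \<open>middle\<close>.\<close>
    then have U: "(UNIV :: 'n set) = {m, M}" by auto
    show ?thesis
    proof (cases "m = M")
      case True
      with energy show ?thesis by (simp add: U)
    next
      case False
      define x y x' y' where "x = cmod (d $ m)" "y = cmod (d $ M)" "x' = cmod (c $ m)" "y' = cmod (c $ M)"
      note defs = this
      \<comment> \<open>The squares of \<open>x, y\<close> and of \<open>x', y'\<close> have equal
        sum and product, so they are the roots of the same quadratic.\<close>
      have sq: "x'\<^sup>2 + y'\<^sup>2 = x\<^sup>2 + y\<^sup>2"
        using energy False by (simp add: U defs)
      have prod: "x' * y' = x * y"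
        using arg_cong[OF conjunct2[OF extreme[OF False]], of cmod]
        by (simp add: norm_mult mult.commute defs)
      have "(x\<^sup>2 - x'\<^sup>2) * (x\<^sup>2 - y'\<^sup>2) = x\<^sup>2 * x\<^sup>2 - x\<^sup>2 * (x'\<^sup>2 + y'\<^sup>2) + (x' * y')\<^sup>2"
        by (simp add: algebra_simps power_mult_distrib)
      also have "\<dots> = 0"
        unfolding sq prod by (simp add: algebra_simps power_mult_distrib)
      finally have "(x\<^sup>2 - x'\<^sup>2) * (x\<^sup>2 - y'\<^sup>2) = 0" .
      then have "x = x' \<or> x = y'"
        by (simp add: defs)
      moreover have "x' > 0" "y' > 0" using c(1) by (simp_all add: defs)
      ultimately show ?thesis
        using prod by (fold defs) auto
    qed
  qed
  \<comment> \<open>As the end moduli of \<open>c\<close> differ when \<open>m\<close> and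
    \<open>M\<close> do, this one equation selects the same alternative of \<open>middle\<close> for
    all \<open>k\<close>.\<close>
  show ?thesis
  proof (cases "cmod (d $ m) = cmod (c $ m)")
    case True
    have "\<exists>b. S $ k - S $ m = T $ b - T $ m \<and> d $ k * cnj (d $ m) = c $ b * cnj (c $ m)" for k
    proof (cases "k = m \<or> k = M")
      case True
      \<comment> \<open>The witness is \<open>b = k\<close>.\<close>
      then show ?thesis 
        using extreme \<open>cmod (d $ m) = _\<close> by (metis complex_norm_square diff_self)
    next
      case False
      then have "m \<noteq> M" using bounds[of k] by auto
      then show ?thesis using middle[of k] False c(2) True by auto
    qed
    then have "\<exists>\<alpha> t\<^sub>0. spike_signal d S = rotation \<alpha> (time_shift t\<^sub>0 (spike_signal c T))"
      by (intro coincide_shift[OF inj(2) True c(1)])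
    then show ?thesis unfolding coincide_up_to_trivial_ambiguities_def by blast
  next
    case False
    then have mM: "m \<noteq> M" and dm: "cmod (d $ m) = cmod (c $ M)" using ends by auto
    \<comment> \<open>These are the parameters of the reflected signal; \<open>T $ M - T $ a\<close>
      becomes \<open>T' $ a - T' $ M\<close>, so the anchor is \<open>M\<close>.\<close>
    define c' T' where "c' = (\<chi> j. cnj (c $ j))" and "T' = (\<chi> j. - (T $ j))"
    have "\<exists>b. S $ k - S $ m = T' $ b - T' $ M \<and> d $ k * cnj (d $ m) = c' $ b * cnj (c' $ M)" for k
    proof -
      have "\<exists>a. S $ k - S $ m = T $ M - T $ a \<and> d $ k * cnj (d $ m) = c $ M * cnj (c $ a)"
      proof (cases "k = m \<or> k = M")
        case True
        \<comment> \<open>Here the ends are swapped: \<open>a = M\<close> for \<open>k = m\<close>,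
          and \<open>a = m\<close> for \<open>k = M\<close>.\<close>
        then show ?thesis
          using extreme[OF mM] dm by (metis complex_norm_square diff_self)
      next
        case F: False
        then show ?thesis using middle[of k] False by auto
      qed
      then show ?thesis by (auto simp: c'_def T'_def mult.commute)
    qed
    then have "\<exists>\<alpha> t\<^sub>0. spike_signal d S = rotation \<alpha> (time_shift t\<^sub>0 (spike_signal c' T'))"
      using dm c(1) by (intro coincide_shift[OF inj(2), where p = M]) (simp_all add: c'_def)
    then show ?thesis
      unfolding coincide_up_to_trivial_ambiguities_def conj_reflection_spike_signal c'_def T'_def by blast
  qed
qed

section \<open>Null sets of exceptional parameters\<close>

text \<open>Each nonzero integer relation cuts out a hyperplane, and there are countably many
  relations.\<close>

lemma negligible_not_integrally_independent:
  "negligible {x :: (complex ^ 'n) \<times> (real ^ 'n). \<not> integrally_independent (snd x)}"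
proof -
  define h :: "('n \<Rightarrow> int) \<Rightarrow> ((complex ^ 'n) \<times> (real ^ 'n)) set"
    where "h v = {x. (0, \<chi> j. of_int (v j)) \<bullet> x = 0}" for v
  have "negligible (h v)" if "v \<noteq> (\<lambda>_. 0)" for v
    unfolding h_def using that by (intro negligible_hyperplane) (auto simp: prod_eq_iff vec_eq_iff)
  then have "negligible (\<Union>(h ` {v. v \<noteq> (\<lambda>_. 0)}))"
    by (intro negligible_countable_Union countable_image) auto
  then show ?thesis
    by (rule negligible_subset)
      (auto simp: integrally_independent_def h_def inner_vec_def inner_prod_def)
qed

text \<open>The inner product with \<open>(axis j 1, 0)\<close> is the real part of the coefficient,
  so the set lies in a hyperplane.\<close>

lemma negligible_coefficient_0:
  "negligible {x :: (complex ^ 'n) \<times> (real ^ 'n). fst x $ j = 0}"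
proof -
  have "negligible {x :: (complex ^ 'n) \<times> (real ^ 'n). (axis j 1, 0) \<bullet> x = 0}"
    by (intro negligible_hyperplane) (auto simp: prod_eq_iff axis_eq_0_iff)
  then show ?thesis
    by (rule negligible_subset) (auto simp: inner_prod_def inner_axis')
qed

lemma negligible_equal_moduli:
  assumes "i \<noteq> j"
  shows "negligible {x :: (complex ^ 'n) \<times> (real ^ 'n). cmod (fst x $ i) = cmod (fst x $ j)}"
proof -
  define H where "H = {x :: (complex ^ 'n) \<times> (real ^ 'n). (axis j 1, 0) \<bullet> x = 0}"
  \<comment> \<open>Where \<open>c\<^sub>i \<noteq> 0\<close>, equality of moduli means \<open>c\<^sub>j = exp w * c\<^sub>i\<close> with \<open>Re w = 0\<close>, so the set is
    the smooth image of a hyperplane.\<close>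
  define \<phi> :: "(complex ^ 'n) \<times> (real ^ 'n) \<Rightarrow> (complex ^ 'n) \<times> (real ^ 'n)"
    where "\<phi> x = (fst x + axis j (exp (fst x $ j) * fst x $ i - fst x $ j), snd x)" for x
  have "negligible H"
    unfolding H_def by (intro negligible_hyperplane) (auto simp: prod_eq_iff axis_eq_0_iff)
  moreover have "\<phi> differentiable_on H"
  proof (rule differentiable_at_imp_differentiable_on)
    fix x
    have nth: "(\<lambda>x :: (complex ^ 'n) \<times> (real ^ 'n). fst x $ k) differentiable at x" for k
      by (rule bounded_linear_imp_differentiable
          [OF bounded_linear_compose[OF bounded_linear_vec_nth bounded_linear_fst]])
    have bounded_linear: "bounded_linear (axis j :: complex \<Rightarrow> complex ^ 'n)"
      by (intro linear_conv_bounded_linear[THEN iffD1] linearI) (auto simp: axis_def vec_eq_iff)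
    have "(\<lambda>x. exp (fst x $ j)) differentiable at x"
      by (rule differentiable_compose[OF field_differentiable_imp_differentiable nth])
        (rule field_differentiable_within_exp)
    then have "(\<lambda>x. axis j (exp (fst x $ j) * fst x $ i - fst x $ j)) differentiable at x"
      by (intro differentiable_compose[OF bounded_linear_imp_differentiable[OF bounded_linear]]
          differentiable_diff differentiable_mult nth)
    then show "\<phi> differentiable at x"
      unfolding \<phi>_def
      by (intro differentiable_Pair differentiable_add
          bounded_linear_imp_differentiable[OF bounded_linear_fst]
          bounded_linear_imp_differentiable[OF bounded_linear_snd])
  qed
  ultimately have image: "negligible (\<phi> ` H)"
    by (intro negligible_differentiable_image_negligible) auto
  have "x \<in> \<phi> ` H \<union> {x. fst x $ i = 0}" if moduli: "cmod (fst x $ i) = cmod (fst x $ j)" for x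
  proof (cases "fst x $ i = 0")
    case False
    obtain \<alpha> where \<alpha>: "fst x $ j = exp (\<i> * complex_of_real \<alpha>) * fst x $ i"
      using unimodular_factor[OF moduli[symmetric] False] .
    \<comment> \<open>The preimage of \<open>x\<close> has the purely imaginary exponent as its
      \<open>j\<close>-th coefficient.\<close>
    define y where "y = (fst x + axis j (\<i> * complex_of_real \<alpha> - fst x $ j), snd x)"
    have "y \<in> H" by (simp add: y_def H_def inner_prod_def inner_axis')
    moreover have "x = \<phi> y"
    proof -
      have "fst y $ i = fst x $ i" "fst y $ j = \<i> * complex_of_real \<alpha>"
        using assms by (simp_all add: y_def axis_def)
      then have "fst (\<phi> y) = fst y + axis j (fst x $ j - \<i> * complex_of_real \<alpha>)"
        using \<alpha> by (simp add: \<phi>_def)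
      also have "\<dots> = fst x"
        unfolding y_def by (simp add: vec_eq_iff axis_def)
      finally show ?thesis
        by (simp add: \<phi>_def y_def prod_eq_iff)
    qed
    ultimately show ?thesis by blast
  qed simp
  then have cover: "{x. cmod (fst x $ i) = cmod (fst x $ j)} \<subseteq> \<phi> ` H \<union> {x. fst x $ i = 0}"
    by blast
  show ?thesis
    by (rule negligible_subset[OF negligible_Un[OF image negligible_coefficient_0] cover])
qed

section \<open>Recovery for almost all parameters\<close>

theorem corollary3p2:
  shows
  "AE (c, T) in (lebesgue :: ((complex ^ 'n::{finite,linorder}) \<times> (real ^ 'n::{finite,linorder})) measure).
     strict_mono (\<lambda>j. T $ j) \<longrightarrow>
     (\<forall>(d :: complex ^ 'n::{finite,linorder}) (S :: real ^ 'n::{finite,linorder}).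
        strict_mono (\<lambda>j. S $ j) \<longrightarrow>
        (\<forall>\<omega>. cmod (fourier (spike_signal d S) \<omega>) = cmod (fourier (spike_signal c T) \<omega>)) \<longrightarrow>
        coincide_up_to_trivial_ambiguities (spike_signal c T) (spike_signal d S))"
proof -
  define m M where "m = Min (UNIV :: 'n::{finite,linorder} set)" and "M = Max (UNIV :: 'n::{finite,linorder} set)"
  \<comment> \<open>For a single spike \<open>m = M\<close> and the moduli always agree; the
    conjunct \<open>m \<noteq> M\<close> keeps the last set from being the whole space.\<close>
  define Z where "Z = {x :: (complex ^ 'n::{finite,linorder}) \<times> (real ^ 'n::{finite,linorder}). \<not> integrally_independent (snd x)} \<union>
    (\<Union>j. {x. fst x $ j = 0}) \<union> {x. m \<noteq> M \<and> cmod (fst x $ m) = cmod (fst x $ M)}"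
  have "negligible {x :: (complex ^ 'n::{finite,linorder}) \<times> (real ^ 'n::{finite,linorder}). m \<noteq> M \<and> cmod (fst x $ m) = cmod (fst x $ M)}"
    using negligible_equal_moduli[of m M] by (cases "m = M") auto
  then have "negligible Z"
    unfolding Z_def
    by (intro negligible_Un negligible_Union negligible_not_integrally_independent)
      (auto intro: negligible_coefficient_0)
  then have "Z \<in> null_sets lebesgue"
    by (simp add: negligible_iff_null_sets)
  then have "AE x in lebesgue. x \<notin> Z"
    by (rule AE_not_in)
  then show ?thesis
  proof eventually_elim
    case (elim x)
    obtain c T where x: "x = (c, T)" by fastforce
    show ?case
      unfolding x split_conv
    proof (intro impI allI)
      fix d :: "complex ^ 'n::{finite,linorder}" and S :: "real ^ 'n::{finite,linorder}"
      assume "strict_mono (($) T)" "strict_mono (($) S)"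
        "\<forall>\<omega>. cmod (fourier (spike_signal d S) \<omega>) = cmod (fourier (spike_signal c T) \<omega>)"
      with elim x show "coincide_up_to_trivial_ambiguities (spike_signal c T) (spike_signal d S)"
        by (intro coincide_up_to_trivial_ambiguitiesI) (auto simp: Z_def m_def M_def)
    qed
  qed
qed

end
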